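(* Let $X_t$ be a BN random process, with $X_t\sim\text{BN}(\boldsymbol{\theta}_t)$, $\boldsymbol{\theta}_t=(\mu_t,\sigma_t,\alpha)$. If $\mu_t$ and $\sigma_t$ are not independent of time (i.e. they are not constant in $t$), then $X_t$ is not strict-sense stationary.
   Context: For $\mu\in\mathbb{R}$, $\sigma>0$, $\alpha\in\mathbb{R}$, BN$(\mu,\sigma,\alpha)$ is the distribution on $\mathbb{R}$ with PDF $$f(x;\mu,\sigma,\alpha)=\frac{1}{\sqrt{2\pi\sigma^2}}\exp\left[-\frac12\left(\frac{x-\mu}{\sigma}\right)^2-\frac{\alpha^2}{2}\right]\cosh\left[\alpha\left(\frac{x-\mu}{\sigma}\right)\right].$$ A process $X_t$ ($t\in\mathbb{R}$) is a BN random process if $X_t\sim\text{BN}(\boldsymbol{\theta}_t)$ for every $t$, where $\boldsymbol{\theta}_t=(\mu_t,\sigma_t,\alpha)$, $\mu_t\in\mathbb{R}$, $\sigma_t>0$, $\alpha\in\mathbb{R}$ ($\alpha$ does not depend on $t$). A process $X_t$ is strict-sense stationary (SSS) if for each $n\in\mathbb{N}$, $t_1<\cdots<t_n$, $(x_1,\ldots,x_n)\in\mathbb{R}^n$ and any time $t_0$, $\mathbb{P}(X_{t_1+t_0}\le x_1,\ldots,X_{t_n+t_0}\le x_n)=\mathbb{P}(X_{t_1}\le x_1,\ldots,X_{t_n}\le x_n)$. *)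

theory Defs
  imports "HOL-Probability.Probability"
begin

definition BN_density :: "real \<Rightarrow> real \<Rightarrow> real \<Rightarrow> real \<Rightarrow> real" where
  "BN_density \<mu> \<sigma> \<alpha> x =
     1 / sqrt (2 * pi * \<sigma>\<^sup>2) * exp (- (1 / 2) * ((x - \<mu>) / \<sigma>)\<^sup>2 - \<alpha>\<^sup>2 / 2)
       * cosh (\<alpha> * ((x - \<mu>) / \<sigma>))"

definition BN_process ::
  "'a measure \<Rightarrow> (real \<Rightarrow> 'a \<Rightarrow> real) \<Rightarrow> (real \<Rightarrow> real) \<Rightarrow> (real \<Rightarrow> real) \<Rightarrow> real \<Rightarrow> bool" where
  "BN_process M X \<mu> \<sigma> \<alpha> \<longleftrightarrow>
     (\<forall>t. \<sigma> t > 0 \<and> distributed M lborel (X t) (\<lambda>x. ennreal (BN_density (\<mu> t) (\<sigma> t) \<alpha> x)))"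

(* Times and thresholds are functions on nat of which only the values at 1, ..., n matter. *)
definition strict_sense_stationary :: "'a measure \<Rightarrow> (real \<Rightarrow> 'a \<Rightarrow> real) \<Rightarrow> bool" where
  "strict_sense_stationary M X \<longleftrightarrow>
     (\<forall>(n::nat) (t::nat \<Rightarrow> real) (x::nat \<Rightarrow> real) (t0::real).
        n \<ge> 1 \<longrightarrow> strict_mono_on {1..n} t \<longrightarrow>
        measure M {\<omega> \<in> space M. \<forall>i\<in>{1..n}. X (t i + t0) \<omega> \<le> x i} =
        measure M {\<omega> \<in> space M. \<forall>i\<in>{1..n}. X (t i) \<omega> \<le> x i})"

end

theory Submission
  imports Defs
begin

text \<open>
  BN\<open>(\<mu>, \<sigma>, \<alpha>)\<close> is the equal mixture of the normal distributions with standard deviation \<open>\<sigma>\<close>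
  and means \<open>\<mu> \<plusminus> \<alpha>\<sigma>\<close>, so it has mean \<open>\<mu>\<close> and second moment \<open>\<mu>\<^sup>2 + \<sigma>\<^sup>2(1 + \<alpha>\<^sup>2)\<close>. For fixed
  \<open>\<alpha>\<close> these determine \<open>\<mu>\<close> and \<open>\<sigma> > 0\<close>. Stationarity with \<open>n = 1\<close> forces all one-dimensional
  marginals, hence these moments, to agree.
\<close>

text \<open>Writing \<open>cosh\<close> as half a sum of two exponentials, each exponential combines
  with the Gaussian factor by completing the square. The factor
  \<open>exp (- \<alpha>\<^sup>2 / 2)\<close> is exactly what this leaves over, so both weights are
  1/2.\<close>

lemma BN_density_eq_normal_mixture:
  assumes "\<sigma> > 0"
  shows "BN_density \<mu> \<sigma> \<alpha> x =
    (normal_density (\<mu> + \<alpha> * \<sigma>) \<sigma> x + normal_density (\<mu> - \<alpha> * \<sigma>) \<sigma> x) / 2"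
proof -
  define z where "z = (x - \<mu>) / \<sigma>"
  have z: "x = \<mu> + \<sigma> * z"
    using assms by (simp add: z_def)
  \<comment> \<open>Stated for general \<open>c\<close> to serve both components: c = \<alpha> and c
    = -\<alpha> share the even part and differ only in the sign of \<open>c * z\<close>.\<close>
  have exponent: "- (x - (\<mu> + c * \<sigma>))\<^sup>2 / (2 * \<sigma>\<^sup>2) = (- (1 / 2) * z\<^sup>2 - c\<^sup>2 / 2) + c * z" for c
    using assms unfolding z by (simp add: field_simps power2_eq_square)
  have plus: "normal_density (\<mu> + \<alpha> * \<sigma>) \<sigma> x =
      1 / sqrt (2 * pi * \<sigma>\<^sup>2) * (exp (- (1 / 2) * z\<^sup>2 - \<alpha>\<^sup>2 / 2) * exp (\<alpha> * z))"
    unfolding normal_density_def exponent exp_add ..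
  have minus: "normal_density (\<mu> - \<alpha> * \<sigma>) \<sigma> x =
      1 / sqrt (2 * pi * \<sigma>\<^sup>2) * (exp (- (1 / 2) * z\<^sup>2 - \<alpha>\<^sup>2 / 2) * exp (- (\<alpha> * z)))"
    using exponent[of "- \<alpha>"] unfolding normal_density_def by (simp add: exp_add[symmetric])
  show ?thesis
    unfolding plus minus BN_density_def z_def[symmetric] cosh_def by (simp add: algebra_simps add_divide_distrib)
qed

lemma BN_density_nonneg: "0 \<le> BN_density \<mu> \<sigma> \<alpha> x"
  by (simp add: BN_density_def)

lemma normal_second_moment:
  assumes "\<sigma> > 0"
  shows "has_bochner_integral lborel (\<lambda>x. normal_density \<mu> \<sigma> x * x\<^sup>2) (\<mu>\<^sup>2 + \<sigma>\<^sup>2)"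
proof -
  \<comment> \<open>Expands x^2 = (x - \<mu>)^2 + 2 \<mu> x - \<mu>^2. The even central moments of
    order 2 and 0 are kept in their general form: the first equals \<sigma>^2, the second is the
    total mass 1.\<close>
  have "has_bochner_integral lborel
      (\<lambda>x. normal_density \<mu> \<sigma> x * (x - \<mu>) ^ (2 * 1) + normal_density \<mu> \<sigma> x * x * (2 * \<mu>)
        - normal_density \<mu> \<sigma> x * (x - \<mu>) ^ (2 * 0) * \<mu>\<^sup>2)
      (fact (2 * 1) / ((2 / \<sigma>\<^sup>2) ^ 1 * fact 1) + \<mu> * (2 * \<mu>)
        - fact (2 * 0) / ((2 / \<sigma>\<^sup>2) ^ 0 * fact 0) * \<mu>\<^sup>2)"
    by (intro has_bochner_integral_add has_bochner_integral_diff has_bochner_integral_mult_left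
        normal_moment_even normal_moment_nz_1 assms)
  then show ?thesis
    by (rule has_bochner_integral_cong[THEN iffD1, rotated -1])
       (auto simp: power2_eq_square algebra_simps)
qed

lemma BN_first_moment:
  assumes "\<sigma> > 0"
  shows "has_bochner_integral lborel (\<lambda>x. BN_density \<mu> \<sigma> \<alpha> x * x) \<mu>"
proof -
  have "has_bochner_integral lborel
      (\<lambda>x. (normal_density (\<mu> + \<alpha> * \<sigma>) \<sigma> x * x + normal_density (\<mu> - \<alpha> * \<sigma>) \<sigma> x * x) * (1 / 2))
      (((\<mu> + \<alpha> * \<sigma>) + (\<mu> - \<alpha> * \<sigma>)) * (1 / 2))"
    by (intro has_bochner_integral_add has_bochner_integral_mult_left normal_moment_nz_1 assms)
  then show ?thesis
    by (rule has_bochner_integral_cong[THEN iffD1, rotated -1])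
       (auto simp: BN_density_eq_normal_mixture assms algebra_simps add_divide_distrib)
qed

lemma BN_second_moment:
  assumes "\<sigma> > 0"
  shows "has_bochner_integral lborel (\<lambda>x. BN_density \<mu> \<sigma> \<alpha> x * x\<^sup>2) (\<mu>\<^sup>2 + \<sigma>\<^sup>2 * (1 + \<alpha>\<^sup>2))"
proof -
  \<comment> \<open>On averaging the two squared means, the cross terms 2 \<mu> \<alpha> \<sigma>
    cancel and \<alpha>^2 \<sigma>^2 remains, to be added to the common variance \<sigma>^2.\<close>
  have "has_bochner_integral lborel
      (\<lambda>x. (normal_density (\<mu> + \<alpha> * \<sigma>) \<sigma> x * x\<^sup>2 + normal_density (\<mu> - \<alpha> * \<sigma>) \<sigma> x * x\<^sup>2) * (1 / 2))
      ((((\<mu> + \<alpha> * \<sigma>)\<^sup>2 + \<sigma>\<^sup>2) + ((\<mu> - \<alpha> * \<sigma>)\<^sup>2 + \<sigma>\<^sup>2)) * (1 / 2))"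
    by (intro has_bochner_integral_add has_bochner_integral_mult_left normal_second_moment assms)
  then show ?thesis
    by (rule has_bochner_integral_cong[THEN iffD1, rotated -1])
       (auto simp: BN_density_eq_normal_mixture assms power2_eq_square algebra_simps add_divide_distrib)
qed

lemma (in prob_space) BN_moments:
  assumes "\<sigma> > 0" and "distributed M lborel Y (\<lambda>x. ennreal (BN_density \<mu> \<sigma> \<alpha> x))"
  shows "expectation Y = \<mu>" and "expectation (\<lambda>\<omega>. (Y \<omega>)\<^sup>2) = \<mu>\<^sup>2 + \<sigma>\<^sup>2 * (1 + \<alpha>\<^sup>2)"
  using distributed_integral[OF assms(2), of "\<lambda>x. x"] distributed_integral[OF assms(2), of "\<lambda>x. x\<^sup>2"]
    has_bochner_integral_integral_eq[OF BN_first_moment[OF assms(1)], of \<mu> \<alpha>]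
    has_bochner_integral_integral_eq[OF BN_second_moment[OF assms(1)], of \<mu> \<alpha>]
  by (simp_all add: BN_density_nonneg)

lemma BN_parameters_unique:
  assumes "prob_space M"
    and "\<sigma> > 0" "distributed M lborel Y (\<lambda>x. ennreal (BN_density \<mu> \<sigma> \<alpha> x))"
    and "\<sigma>' > 0" "distributed M lborel Z (\<lambda>x. ennreal (BN_density \<mu>' \<sigma>' \<alpha> x))"
    and "distr M borel Y = distr M borel Z"
  shows "\<mu> = \<mu>'" and "\<sigma> = \<sigma>'"
proof -
  interpret prob_space M by fact
  have [measurable]: "Y \<in> borel_measurable M" "Z \<in> borel_measurable M"
    using assms(3,5) by (auto dest: distributed_measurable)
  \<comment> \<open>Such an expectation is the integral of \<open>g\<close> against the law, which
    is shared; it is applied to the identity and to the square.\<close>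
  have transfer: "expectation (\<lambda>\<omega>. g (Y \<omega>)) = expectation (\<lambda>\<omega>. g (Z \<omega>))"
    if "g \<in> borel_measurable borel" for g :: "real \<Rightarrow> real"
    using that integral_distr[of Y M borel g] integral_distr[of Z M borel g] assms(6) by simp
  show \<mu>: "\<mu> = \<mu>'"
    using transfer[of "\<lambda>x. x"] BN_moments(1)[OF assms(2,3)] BN_moments(1)[OF assms(4,5)] by simp
  have "\<sigma>\<^sup>2 * (1 + \<alpha>\<^sup>2) = \<sigma>'\<^sup>2 * (1 + \<alpha>\<^sup>2)"
    using transfer[of "\<lambda>x. x\<^sup>2"] BN_moments(2)[OF assms(2,3)] BN_moments(2)[OF assms(4,5)] \<mu> by simp
  \<comment> \<open>Having the same \<alpha> on both sides allows this factor to be cancelled;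
    positivity of both scales then selects the same square root.\<close>
  moreover have "1 + \<alpha>\<^sup>2 \<noteq> 0"
    by (metis add_pos_nonneg less_irrefl zero_le_power2 zero_less_one)
  ultimately show "\<sigma> = \<sigma>'"
    using assms(2,4) by simp
qed

text \<open>The case n = 1 equates the distribution functions at any two times, and a distribution
  function determines its law.\<close>

lemma strict_sense_stationary_distr_eq:
  assumes "prob_space M" and "strict_sense_stationary M X"
    and [measurable]: "\<And>t. X t \<in> borel_measurable M"
  shows "distr M borel (X s) = distr M borel (X t)"
proof -
  interpret prob_space M by fact
  have cdf: "cdf (distr M borel (X r)) x = prob {\<omega> \<in> space M. X r \<omega> \<le> x}" for r x
    by (simp add: cdf_def measure_distr vimage_def Int_def conj_commute)
  have "prob {\<omega> \<in> space M. X s \<omega> \<le> x} = prob {\<omega> \<in> space M. X t \<omega> \<le> x}" for x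
    \<comment> \<open>The shift \<open>s - t\<close> carries time \<open>t\<close> to
      \<open>s\<close>. The constant time function is admissible because strict monotonicity on the
      singleton \<open>{1..1}\<close> is vacuous.\<close>
    using assms(2)[unfolded strict_sense_stationary_def, rule_format, of 1 "\<lambda>_. t" "s - t" "\<lambda>_. x"]
    by (simp add: strict_mono_on_def)
  then show ?thesis
    by (intro cdf_unique real_distribution_distr) (auto simp: cdf)
qed

theorem proposition8p2:
  fixes M :: "'a measure"
    and X :: "real \<Rightarrow> 'a \<Rightarrow> real"
    and \<mu> \<sigma> :: "real \<Rightarrow> real"
    and \<alpha> :: real
  assumes "prob_space M"
    and "BN_process M X \<mu> \<sigma> \<alpha>"
    and "\<not> (\<mu> constant_on UNIV \<and> \<sigma> constant_on UNIV)"
  shows "\<not> strict_sense_stationary M X"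
proof
  assume stationary: "strict_sense_stationary M X"
  have \<sigma>: "\<sigma> t > 0"
    and X: "distributed M lborel (X t) (\<lambda>x. ennreal (BN_density (\<mu> t) (\<sigma> t) \<alpha> x))" for t
    using assms(2) by (auto simp: BN_process_def)
  have "X t \<in> borel_measurable M" for t
    using distributed_measurable[OF X] by simp
  then have "distr M borel (X t) = distr M borel (X 0)" for t
    by (rule strict_sense_stationary_distr_eq[OF assms(1) stationary])
  \<comment> \<open>Time 0 is an arbitrary reference point whose parameters witness constancy. Both
    functions come out constant, so variation of even one of them is contradictory.\<close>
  then have "\<mu> t = \<mu> 0" "\<sigma> t = \<sigma> 0" for t
    using BN_parameters_unique[OF assms(1) \<sigma> X \<sigma> X] by blast+
  then show False
    using assms(3) unfolding constant_on_def by blast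
qed

end
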